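(* Let $(t_0,x_0)\in V$ and let $(x,u)\in\mathrm{traj}_{t_0,x_0}$ be an admissible trajectory starting at $x_0$ at time $t_0$. Let $\epsilon>0$ and assume that $v\in\mathcal{C}^1([0,1]\times X)$ satisfies $$l(x(t),u(t)) + \frac{\partial v}{\partial t}(t,x(t)) + \frac{\partial v}{\partial x}(t,x(t))\cdot f(x(t),u(t)) \le \frac{\epsilon}{2}\quad\text{for almost all } t\in[t_0,1],$$ $$l_T(x(1)) - v(1,x(1)) \le \frac{\epsilon}{2}.$$ Then $v^*(t,x(t)) \le v(t,x(t)) + \epsilon$ for all $t\in[t_0,1]$. If, in addition, $v$ satisfies $$l(y,w) + \frac{\partial v}{\partial t}(t,y) + \frac{\partial v}{\partial x}(t,y)\cdot f(y,w) \ge 0 \quad \text{for all } (y,w,t)\in X\times U\times[0,1],$$ $$l_T(y) - v(1,y) \ge 0 \quad \text{for all } y\in X_T,$$ then $(x,u)$ is at most $\epsilon$ sub-optimal for the optimal control problem defining $v^*(t_0,x_0)$, i.e. it is feasible and $$\int_{t_0}^1 l(x(t),u(t))\,dt + l_T(x(1)) \le v^*(t_0,x_0)+\epsilon.$$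
   Context: For $A\subseteq\mathbb{R}^n$, $\mathcal{C}(A)$ is the space of continuous functions $A\to\mathbb{R}$ and $\mathcal{C}^1(A)$ the space of continuously differentiable functions $A\to\mathbb{R}$ (for a compact set $A$: functions admitting a $\mathcal{C}^1$ extension to an open neighbourhood of $A$, with partial derivatives on $A$ being those of a fixed such extension). The symbol $\cdot$ is the Euclidean dot product; $\partial v/\partial x$ denotes the gradient of $v(t,x)$ with respect to its second (state) argument. Let $X\subseteq\mathbb{R}^{d_X}$ (state space) and $U\subseteq\mathbb{R}^{d_U}$ (control space) be compact, let $X_T\subseteq X$ be compact, let $f\in\mathcal{C}^1(X\times U)^{d_X}$ be the dynamics, let $l\in\mathcal{C}(X\times U)$ be the Lagrangian and $l_T\in\mathcal{C}(X_T)$ the terminal cost. The time interval is $[0,1]$, with terminal time $1$. Admissible trajectories: for $t_0\in[0,1]$ and $x_0\in X$, $\mathrm{traj}_{t_0,x_0}$ is the set of pairs $(x,u)$ of functions on $[t_0,1]$ such that $u:[t_0,1]\to U$ is measurable, $x(t)\in X$ for all $t\in[t_0,1]$, $x(t)=x_0+\int_{t_0}^t f(x(s),u(s))\,ds$ for all $t\in[t_0,1]$, and $x(1)\in X_T$. Value function: $v^*:[0,1]\times X\to\mathbb{R}\cup\{+\infty\}$, $$v^*(t_0,x_0)=\inf_{(x,u)\in\mathrm{traj}_{t_0,x_0}} \int_{t_0}^1 l(x(t),u(t))\,dt + l_T(x(1)),$$ with $v^*(t_0,x_0)=+\infty$ if $\mathrm{traj}_{t_0,x_0}=\emptyset$.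 Its domain is $V=\{(t_0,x_0)\in[0,1]\times X:\ \mathrm{traj}_{t_0,x_0}\neq\emptyset\}$. *)

theory Defs
  imports "HOL-Analysis.Analysis"
begin

definition continuously_differentiable ::
    "'a::real_normed_vector set \<Rightarrow> ('a \<Rightarrow> 'b::real_normed_vector) \<Rightarrow> bool" where
  "continuously_differentiable W g \<longleftrightarrow> open W \<and>
     (\<exists>g' :: 'a \<Rightarrow> 'a \<Rightarrow>\<^sub>L 'b.
        (\<forall>z\<in>W. (g has_derivative blinfun_apply (g' z)) (at z)) \<and> continuous_on W g')"

text \<open>
  For a compact set \<open>A\<close>, a function is of class \<open>C\<^sup>1\<close> on \<open>A\<close> if it has a \<open>C\<^sup>1\<close> extension to an open
  neighbourhood of \<open>A\<close>. Its partial derivatives on \<open>A\<close> depend on the choice of the extension, so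
  the extension \<open>g\<close> of \<open>h\<close> is an explicit argument. Values of \<open>h\<close> outside \<open>A\<close>, and values of \<open>g\<close>
  outside the neighbourhood, are irrelevant.
\<close>

definition C1_extension ::
    "'a::real_normed_vector set \<Rightarrow> ('a \<Rightarrow> 'b::real_normed_vector) \<Rightarrow> ('a \<Rightarrow> 'b) \<Rightarrow> bool" where
  "C1_extension A h g \<longleftrightarrow>
     (\<exists>W. A \<subseteq> W \<and> continuously_differentiable W g) \<and> (\<forall>z\<in>A. g z = h z)"

definition C1_on :: "'a::real_normed_vector set \<Rightarrow> ('a \<Rightarrow> 'b::real_normed_vector) \<Rightarrow> bool" where
  "C1_on A h \<longleftrightarrow> (\<exists>g. C1_extension A h g)"

definition gradient :: "('a::real_inner \<Rightarrow> real) \<Rightarrow> 'a \<Rightarrow> 'a" where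
  "gradient g y = (THE D. GDERIV g y :> D)"

lemma gradient_eqI:
  assumes "GDERIV g y :> D"
  shows "gradient g y = D"
  unfolding gradient_def
proof (rule the_equality)
  show "GDERIV g y :> D" by (fact assms)
next
  fix E assume "GDERIV g y :> E"
  with assms have "(\<lambda>h. inner h E) = (\<lambda>h. inner h D)"
    unfolding gderiv_def by (metis has_derivative_unique)
  then show "E = D"
    by (metis inner_commute vector_eq_rdot)
qed

definition partial_time :: "(real \<times> 'a \<Rightarrow> real) \<Rightarrow> real \<Rightarrow> 'a \<Rightarrow> real" where
  "partial_time g t y = deriv (\<lambda>s. g (s, y)) t"

definition partial_state :: "(real \<times> 'a::real_inner \<Rightarrow> real) \<Rightarrow> real \<Rightarrow> 'a \<Rightarrow> 'a" where
  "partial_state g t y = gradient (\<lambda>z. g (t, z)) y"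

text \<open>
  Trajectories are total functions constrained on \<open>{t0..1}\<close> only. The integrability clause makes
  explicit that the integral in the state equation exists, since the Bochner integral of a
  non-integrable function is \<open>0\<close> by convention.
\<close>

definition traj ::
    "(real^'n) set \<Rightarrow> (real^'m) set \<Rightarrow> (real^'n) set \<Rightarrow> ((real^'n) \<times> (real^'m) \<Rightarrow> real^'n) \<Rightarrow>
     real \<Rightarrow> real^'n \<Rightarrow> ((real \<Rightarrow> real^'n) \<times> (real \<Rightarrow> real^'m)) set" where
  "traj X U XT f t0 x0 =
     {(x, u).
        u \<in> borel_measurable (lebesgue_on {t0..1}) \<and> (\<forall>t\<in>{t0..1}. u t \<in> U) \<and>
        (\<forall>t\<in>{t0..1}. x t \<in> X) \<and>
        set_integrable lebesgue {t0..1} (\<lambda>s. f (x s, u s)) \<and>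
        (\<forall>t\<in>{t0..1}. x t = x0 + (LINT s:{t0..t}|lebesgue. f (x s, u s))) \<and>
        x 1 \<in> XT}"

definition cost ::
    "((real^'n) \<times> (real^'m) \<Rightarrow> real) \<Rightarrow> (real^'n \<Rightarrow> real) \<Rightarrow> real \<Rightarrow>
     (real \<Rightarrow> real^'n) \<Rightarrow> (real \<Rightarrow> real^'m) \<Rightarrow> real" where
  "cost l lT t0 x u = (LINT t:{t0..1}|lebesgue. l (x t, u t)) + lT (x 1)"

text \<open>In \<^typ>\<open>ereal\<close> the infimum over the empty set is \<open>\<infinity>\<close>.\<close>

definition value_function ::
    "(real^'n) set \<Rightarrow> (real^'m) set \<Rightarrow> (real^'n) set \<Rightarrow> ((real^'n) \<times> (real^'m) \<Rightarrow> real^'n) \<Rightarrow>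
     ((real^'n) \<times> (real^'m) \<Rightarrow> real) \<Rightarrow> (real^'n \<Rightarrow> real) \<Rightarrow> real \<Rightarrow> real^'n \<Rightarrow> ereal" where
  "value_function X U XT f l lT t0 x0 =
     (INF (x, u)\<in>traj X U XT f t0 x0. ereal (cost l lT t0 x u))"

definition value_domain ::
    "(real^'n) set \<Rightarrow> (real^'m) set \<Rightarrow> (real^'n) set \<Rightarrow> ((real^'n) \<times> (real^'m) \<Rightarrow> real^'n) \<Rightarrow>
     (real \<times> (real^'n)) set" where
  "value_domain X U XT f = {(t0, x0) \<in> {0..1} \<times> X. traj X U XT f t0 x0 \<noteq> {}}"

end

theory Submission
  imports Defs
begin

text \<open>
  Along an admissible trajectory put \<open>z s = (s, x s)\<close> and \<open>k s = (1, f (x s, u s))\<close>. Then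
  \<open>v (1, x 1) - v (t, x t)\<close> is the integral of \<open>Dv (z s) (k s)\<close> over \<open>[t, 1]\<close>, so the cost from
  time \<open>t\<close> is \<open>v (t, x t)\<close> plus the terminal defect \<open>lT (x 1) - v (1, x 1)\<close> plus the integral of
  the Hamilton-Jacobi-Bellman expression. The approximate inequalities bound both corrections from
  above by \<open>\<epsilon> / 2\<close>, and the exact inequalities make them nonnegative on every competitor, which
  bounds the infimum from below by \<open>v (t0, x0)\<close>.

  The chain rule needs no almost-everywhere differentiation. Since \<open>k\<close> is bounded and
  \<open>Dv (z s)\<close> is continuous in \<open>s\<close>, replacing \<open>Dv (z s)\<close> by its value at a fixed \<open>r\<close> changes the
  integral from \<open>r\<close> to \<open>t\<close> by \<open>o (t - r)\<close>. Hence \<open>v (z t)\<close> minus the integral has derivative \<open>0\<close> at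
  every point, even where \<open>z\<close> is not differentiable.
\<close>

section \<open>Chain rule along integral curves of bounded integrable velocity fields\<close>

lemma integral_curve_chain_rule:
  fixes z k :: "real \<Rightarrow> 'a::euclidean_space" and g :: "'a \<Rightarrow> real"
  assumes "a \<le> b"
    and k: "k absolutely_integrable_on {a..b}"
    and M: "\<And>s. s \<in> {a..b} \<Longrightarrow> norm (k s) \<le> M"
    and z: "\<And>t. t \<in> {a..b} \<Longrightarrow> z t = z a + integral {a..t} k"
    and g': "\<And>s. s \<in> {a..b} \<Longrightarrow> (g has_derivative blinfun_apply (g' (z s))) (at (z s))"
    and cont: "continuous_on {a..b} (\<lambda>s. g' (z s))"
  shows "(\<lambda>s. blinfun_apply (g' (z s)) (k s)) absolutely_integrable_on {a..b}"
    and "((\<lambda>s. blinfun_apply (g' (z s)) (k s)) has_integral g (z b) - g (z a)) {a..b}"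
proof -
  let ?p = "\<lambda>s. blinfun_apply (g' (z s)) (k s)"
  have k_int: "k integrable_on {a..b}"
    using k by (simp add: absolutely_integrable_on_def)
  \<comment> \<open>In coordinates each summand is a continuous, hence bounded and measurable,
    factor times an integrable one; this gives absolute integrability of the pairing.\<close>
  have expand: "?p s = (\<Sum>e\<in>Basis. blinfun_apply (g' (z s)) e * (k s \<bullet> e))" for s
  proof -
    have "?p s = blinfun_apply (g' (z s)) (\<Sum>e\<in>Basis. (k s \<bullet> e) *\<^sub>R e)"
      by (simp add: euclidean_representation)
    then show ?thesis
      by (simp add: blinfun.sum_right blinfun.scaleR_right mult.commute)
  qed
  have "(\<lambda>s. blinfun_apply (g' (z s)) e * (k s \<bullet> e)) absolutely_integrable_on {a..b}" for e
  proof (rule absolutely_integrable_bounded_measurable_product[where h = "(*)"])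
    have c: "continuous_on {a..b} (\<lambda>s. blinfun_apply (g' (z s)) e)"
      by (intro continuous_intros cont)
    show "(\<lambda>s. blinfun_apply (g' (z s)) e) \<in> borel_measurable (lebesgue_on {a..b})"
      by (rule continuous_imp_measurable_on_sets_lebesgue[OF c]) simp
    show "bounded ((\<lambda>s. blinfun_apply (g' (z s)) e) ` {a..b})"
      using c by (intro compact_imp_bounded compact_continuous_image) auto
    show "(\<lambda>s. k s \<bullet> e) absolutely_integrable_on {a..b}"
      using absolutely_integrable_linear[OF k bounded_linear_inner_left[of e]] by (simp add: o_def)
  qed (auto simp: bilinear_times)
  then show "?p absolutely_integrable_on {a..b}"
    unfolding expand by (rule absolutely_integrable_sum[rotated]) simp_all
  then have p_int: "?p integrable_on {a..b}"
    by (simp add: absolutely_integrable_on_def)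
  \<comment> \<open>The added 1 makes \<open>M'\<close> strictly positive; \<open>e\<close> and the
    radius \<open>d1 / M'\<close> below divide by it.\<close>
  define M' where "M' = max M 0 + 1"
  have M': "M' > 0" "\<And>s. s \<in> {a..b} \<Longrightarrow> norm (k s) \<le> M'"
    using M by (force simp: M'_def)+
  have z_diff: "((k has_integral (z t - z s)) {s..t})" if "a \<le> s" "s \<le> t" "t \<le> b" for s t
  proof -
    have "integral {a..s} k + integral {s..t} k = integral {a..t} k"
      using that by (intro Henstock_Kurzweil_Integration.integral_combine
          integrable_on_subinterval[OF k_int]) auto
    then have "integral {s..t} k = z t - z s"
      using z[of s] z[of t] that by (simp add: algebra_simps)
    moreover have "k integrable_on {s..t}"
      using that by (intro integrable_on_subinterval[OF k_int]) auto
    ultimately show ?thesis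
      by (metis integrable_integral)
  qed
  have z_lip: "norm (z t - z s) \<le> M' * \<bar>t - s\<bar>" if "s \<in> {a..b}" "t \<in> {a..b}" for s t
  proof -
    have *: "norm (z t - z s) \<le> M' * (t - s)" if "a \<le> s" "s \<le> t" "t \<le> b" for s t
      using has_integral_bound[of M' k "z t - z s" s t] z_diff[OF that] M' that
      by (auto simp: content_real)
    show ?thesis
      using *[of s t] *[of t s] that by (cases "s \<le> t") (auto simp: norm_minus_commute)
  qed
  define F where "F = (\<lambda>t. g (z t) - integral {a..t} ?p)"
  \<comment> \<open>With the derivative frozen at \<open>z r\<close>, subtracting the first-order
    remainder of \<open>g\<close> leaves exactly the integral of
    \<open>(g' (z r) - g' (z q)) (k q)\<close> over \<open>{s..t}\<close>. The point
    \<open>r\<close> is kept apart from \<open>s\<close> and \<open>t\<close> because it serves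
    below as either endpoint.\<close>
  have F_diff: "\<bar>F t - F s - (g (z t) - g (z s) - g' (z r) (z t - z s))\<bar> \<le> e * M' * (t - s)"
    if st: "a \<le> s" "s \<le> t" "t \<le> b" and "e > 0"
      and e: "\<And>q. q \<in> {s..t} \<Longrightarrow> norm (g' (z r) - g' (z q)) \<le> e" for r s t e
  proof -
    have "integral {a..s} ?p + integral {s..t} ?p = integral {a..t} ?p"
      using st by (intro Henstock_Kurzweil_Integration.integral_combine
          integrable_on_subinterval[OF p_int]) auto
    then have F_eq: "F t - F s - (g (z t) - g (z s) - g' (z r) (z t - z s)) =
        g' (z r) (z t - z s) - integral {s..t} ?p"
      unfolding F_def by linarith
    have "(?p has_integral integral {s..t} ?p) {s..t}"
      using st by (intro integrable_integral integrable_on_subinterval[OF p_int]) auto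
    moreover have "((\<lambda>q. g' (z r) (k q)) has_integral g' (z r) (z t - z s)) {s..t}"
      using has_integral_linear[OF z_diff[OF st] blinfun.bounded_linear_right[of "g' (z r)"]]
      by (simp add: o_def)
    ultimately have *: "((\<lambda>q. g' (z r) (k q) - ?p q) has_integral
        F t - F s - (g (z t) - g (z s) - g' (z r) (z t - z s))) {s..t}"
      unfolding F_eq by (rule has_integral_diff[rotated])
    have "norm (g' (z r) (k q) - ?p q) \<le> e * M'" if "q \<in> {s..t}" for q
    proof -
      have "norm (g' (z r) (k q) - ?p q) = norm ((g' (z r) - g' (z q)) (k q))"
        by (simp add: blinfun.diff_left)
      also have "\<dots> \<le> norm (g' (z r) - g' (z q)) * norm (k q)"
        by (rule norm_blinfun)
      also have "\<dots> \<le> e * M'"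
        using e[OF that] M'(2)[of q] that st \<open>e > 0\<close> by (intro mult_mono) auto
      finally show ?thesis .
    qed
    then show ?thesis
      using has_integral_bound[of "e * M'" _ _ s t] * M' \<open>e > 0\<close> st by (force simp: content_real)
  qed
  have "(F has_derivative (\<lambda>h. 0)) (at r within {a..b})" if r: "r \<in> {a..b}" for r
    unfolding has_derivative_within_alt
  proof (intro conjI allI impI)
    show "bounded_linear (\<lambda>h::real. 0::real)"
      by (rule bounded_linear_zero)
    fix c :: real assume "0 < c"
    \<comment> \<open>Two errors occur, the remainder of \<open>g\<close> at \<open>z r\<close> and
      the freezing error from \<open>F_diff\<close>. Each is at most
      \<open>e * M' * \<bar>t - r\<bar>\<close>, so the factor 2 makes their sum fit into
      \<open>c * \<bar>t - r\<bar>\<close>.\<close>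
    define e where "e = c / (2 * M')"
    have "e > 0" using \<open>0 < c\<close> M' by (simp add: e_def)
    obtain d1 where d1: "d1 > 0"
      "\<And>y. norm (y - z r) < d1 \<Longrightarrow> norm (g y - g (z r) - g' (z r) (y - z r)) \<le> e * norm (y - z r)"
      using g'[OF r] \<open>e > 0\<close> unfolding has_derivative_at_alt by meson
    obtain d2 where d2: "d2 > 0"
      "\<And>q. q \<in> {a..b} \<Longrightarrow> dist q r < d2 \<Longrightarrow> dist (g' (z q)) (g' (z r)) < e"
      using cont r \<open>e > 0\<close> unfolding continuous_on_iff by meson
    \<comment> \<open>By the Lipschitz bound, \<open>d1 / M'\<close> keeps \<open>z t\<close> within
      \<open>d1\<close> of \<open>z r\<close>; \<open>d2\<close> controls \<open>g' (z q)\<close>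
      for every \<open>q\<close> between \<open>r\<close> and \<open>t\<close>, not merely at
      \<open>t\<close>.\<close>
    have "norm (F t - F r) \<le> c * norm (t - r)"
      if t: "t \<in> {a..b}" "norm (t - r) < min (d1 / M') d2" for t
    proof -
      have lip: "norm (z t - z r) \<le> M' * \<bar>t - r\<bar>"
        using z_lip[OF r t(1)] .
      also have "\<dots> < d1"
        using t(2) M' by (simp add: field_simps)
      finally have "norm (g (z t) - g (z r) - g' (z r) (z t - z r)) \<le> e * norm (z t - z r)"
        by (rule d1)
      also have "\<dots> \<le> e * (M' * \<bar>t - r\<bar>)"
        using lip \<open>e > 0\<close> by (intro mult_left_mono) auto
      finally have 1: "\<bar>g (z t) - g (z r) - g' (z r) (z t - z r)\<bar> \<le> e * M' * \<bar>t - r\<bar>"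
        by simp
      have near: "norm (g' (z r) - g' (z q)) \<le> e" if "q \<in> {min r t..max r t}" for q
        using d2(2)[of q] that r t by (auto simp: dist_norm norm_minus_commute min_def max_def split: if_splits)
      have 2: "\<bar>F t - F r - (g (z t) - g (z r) - g' (z r) (z t - z r))\<bar> \<le> e * M' * \<bar>t - r\<bar>"
      proof (cases "r \<le> t")
        case True
        then show ?thesis
          using F_diff[of r t e r] near r t \<open>e > 0\<close> by auto
      next
        \<comment> \<open>Exchanging the endpoints negates the whole expression while the derivative
          stays frozen at \<open>r\<close>, so the estimate on \<open>{t..r}\<close>
          suffices.\<close>
        case False
        then have "\<bar>F r - F t - (g (z r) - g (z t) - g' (z r) (z r - z t))\<bar> \<le> e * M' * (r - t)"
          using near r t \<open>e > 0\<close> by (intro F_diff) auto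
        moreover have "g' (z r) (z r - z t) = - g' (z r) (z t - z r)"
          by (simp add: blinfun.diff_right)
        ultimately show ?thesis
          using False by (simp add: abs_le_iff)
      qed
      have "e * M' + e * M' = c"
        using M' by (simp add: e_def)
      then have "e * M' * \<bar>t - r\<bar> + e * M' * \<bar>t - r\<bar> = c * \<bar>t - r\<bar>"
        by (metis distrib_right)
      with 1 2 show ?thesis
        unfolding real_norm_def by linarith
    qed
    then show "\<exists>d>0. \<forall>y\<in>{a..b}. norm (y - r) < d \<longrightarrow> norm (F y - F r - 0) \<le> c * norm (y - r)"
      using d1(1) d2(1) M'(1) by (intro exI[of _ "min (d1 / M') d2"]) auto
  qed
  then have "F b = F a"
    using \<open>a \<le> b\<close> has_derivative_zero_unique[of "{a..b}" F b a] by auto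
  then show "(?p has_integral g (z b) - g (z a)) {a..b}"
    using p_int by (simp add: F_def has_integral_iff)
qed

section \<open>Partial derivatives of a continuously differentiable extension\<close>

text \<open>The velocity of a curve \<open>(s, x s)\<close> has time component 1, so only vectors
  \<open>(1, h)\<close> matter; by linearity they split into \<open>(1, 0)\<close> and
  \<open>(0, h)\<close>. The extension is differentiable on an open set, so both slices have
  two-sided derivatives, even at times 0 and 1.\<close>

lemma C1_extension_partials:
  fixes v g :: "real \<times> 'a::euclidean_space \<Rightarrow> real"
  assumes "C1_extension A v g"
  obtains g' :: "real \<times> 'a \<Rightarrow> (real \<times> 'a) \<Rightarrow>\<^sub>L real"
    where "\<And>p. p \<in> A \<Longrightarrow> (g has_derivative blinfun_apply (g' p)) (at p)"
      and "continuous_on A g'"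
      and "\<And>t y h. (t, y) \<in> A \<Longrightarrow>
        blinfun_apply (g' (t, y)) (1, h) = partial_time g t y + partial_state g t y \<bullet> h"
proof -
  obtain W g' where W: "A \<subseteq> W"
      and g': "\<And>p. p \<in> W \<Longrightarrow> (g has_derivative blinfun_apply (g' p)) (at p)"
      and cont: "continuous_on W g'"
    using assms unfolding C1_extension_def continuously_differentiable_def by blast
  have "blinfun_apply (g' (t, y)) (1, h) = partial_time g t y + partial_state g t y \<bullet> h"
    if "(t, y) \<in> A" for t y h
  proof -
    let ?D = "blinfun_apply (g' (t, y))"
    have D: "(g has_derivative ?D) (at (t, y))"
      using g' that W by blast
    have "((\<lambda>s. g (s, y)) has_derivative (\<lambda>s. ?D (s, 0))) (at t)"
      by (rule has_derivative_compose[of "\<lambda>s. (s, y)" "\<lambda>s. (s, 0)" t UNIV g ?D, simplified])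
        (use D in \<open>auto intro!: derivative_eq_intros\<close>)
    moreover have "(\<lambda>s. ?D (s, 0)) = (*) (?D (1, 0))"
    proof
      fix s
      show "?D (s, 0) = ?D (1, 0) * s"
        using blinfun.scaleR_right[of "g' (t, y)" s "(1, 0)"] by (simp add: mult.commute)
    qed
    ultimately have "((\<lambda>s. g (s, y)) has_real_derivative ?D (1, 0)) (at t)"
      by (simp only: has_field_derivative_def)
    then have time: "partial_time g t y = ?D (1, 0)"
      by (simp add: partial_time_def DERIV_imp_deriv)
    have lin: "linear (\<lambda>h. ?D (0, h))"
      by (intro bounded_linear.linear bounded_linear_compose[OF blinfun.bounded_linear_right]
          bounded_linear_Pair bounded_linear_zero bounded_linear_ident)
    have "((\<lambda>z. g (t, z)) has_derivative (\<lambda>h. ?D (0, h))) (at y)"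
      by (rule has_derivative_compose[of "\<lambda>z. (t, z)" "\<lambda>h. (0, h)" y UNIV g ?D, simplified])
        (use D in \<open>auto intro!: derivative_eq_intros\<close>)
    \<comment> \<open>The vector representing the functional \<open>h \<mapsto> ?D (0, h)\<close> as
      an inner product, obtained as the adjoint applied to 1.\<close>
    moreover define a where "a = adjoint (\<lambda>h. ?D (0, h)) 1"
    have repr: "?D (0, h) = h \<bullet> a" for h
      using adjoint_works[OF lin, of h 1] by (simp add: a_def)
    ultimately have "GDERIV (\<lambda>z. g (t, z)) y :> a"
      by (simp add: gderiv_def)
    then have "partial_state g t y = a"
      unfolding partial_state_def by (rule gradient_eqI)
    then have state: "partial_state g t y \<bullet> h = ?D (0, h)"
      using repr[of h] by (simp add: inner_commute)
    show ?thesis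
      using time state blinfun.add_right[of "g' (t, y)" "(1, 0)" "(0, h)"] by simp
  qed
  with that g' W cont show thesis
    by (meson continuous_on_subset subsetD)
qed

section \<open>Regularity and restriction of admissible trajectories\<close>

lemma traj_continuous:
  assumes "(x, u) \<in> traj X U XT f t0 x0"
  shows "continuous_on {t0..1} x"
proof -
  have int: "set_integrable lebesgue {t0..1} (\<lambda>s. f (x s, u s))"
    using assms by (simp add: traj_def)
  have "x t = x0 + integral {t0..t} (\<lambda>s. f (x s, u s))" if "t \<in> {t0..1}" for t
  proof -
    have "set_integrable lebesgue {t0..t} (\<lambda>s. f (x s, u s))"
      using that by (intro set_integrable_subset[OF int]) auto
    then show ?thesis
      using assms that by (simp add: traj_def set_lebesgue_integral_eq_integral(2))
  qed
  moreover have "continuous_on {t0..1} (\<lambda>t. x0 + integral {t0..t} (\<lambda>s. f (x s, u s)))"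
    using int by (intro continuous_intros indefinite_integral_continuous_1)
      (rule set_lebesgue_integral_eq_integral(1))
  ultimately show ?thesis
    by (metis (no_types, lifting) continuous_on_cong)
qed

text \<open>Additivity of the integral lets the state equation restart at \<open>(t, x t)\<close>.
  The tail is thereby a competitor in the infimum defining the value function there.\<close>

lemma traj_restrict:
  assumes "(x, u) \<in> traj X U XT f t0 x0" and "t \<in> {t0..1}"
  shows "(x, u) \<in> traj X U XT f t (x t)"
proof -
  let ?k = "\<lambda>s. f (x s, u s)"
  have int: "set_integrable lebesgue {t0..1} ?k"
    using assms by (simp add: traj_def)
  have "x r = x t + (LINT s:{t..r}|lebesgue. ?k s)" if "r \<in> {t..1}" for r
  proof -
    have sub: "set_integrable lebesgue S ?k" if "S \<subseteq> {t0..1}" "S \<in> sets lebesgue" for S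
      using that by (intro set_integrable_subset[OF int])
    have "integral {t0..t} ?k + integral {t..r} ?k = integral {t0..r} ?k"
      using assms(2) that
      by (intro Henstock_Kurzweil_Integration.integral_combine set_lebesgue_integral_eq_integral sub)
        auto
    moreover have "x q = x0 + integral {t0..q} ?k" if "q \<in> {t0..1}" for q
      using assms(1) that sub[of "{t0..q}"]
      by (simp add: traj_def set_lebesgue_integral_eq_integral(2))
    ultimately show ?thesis
      using assms(2) that sub[of "{t..r}"] by (simp add: set_lebesgue_integral_eq_integral(2))
  qed
  moreover have "u \<in> borel_measurable (lebesgue_on {t..1})"
    using assms by (auto simp: traj_def elim!: measurable_restrict_mono)
  moreover have "set_integrable lebesgue {t..1} ?k"
    using assms(2) by (intro set_integrable_subset[OF int]) auto
  moreover have "(\<forall>s\<in>{t..1}. u s \<in> U) \<and> (\<forall>s\<in>{t..1}. x s \<in> X) \<and> x 1 \<in> XT"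
    using assms by (auto simp: traj_def)
  ultimately show ?thesis
    unfolding traj_def by blast
qed

lemma traj_initial:
  assumes "(x, u) \<in> traj X U XT f t0 x0" and "t0 \<le> 1"
  shows "x t0 = x0"
proof -
  have "set_integrable lebesgue {t0..t0} (\<lambda>s. f (x s, u s))"
    by (rule set_integrable_subset[of _ "{t0..1}"]) (use assms in \<open>auto simp: traj_def\<close>)
  then have "(LINT s:{t0..t0}|lebesgue. f (x s, u s)) = 0"
    by (simp add: set_lebesgue_integral_eq_integral(2))
  then show ?thesis
    using assms by (auto simp: traj_def)
qed

text \<open>Admissibility asserts integrability of the dynamics only. For the running cost it
  follows because \<open>l\<close> is bounded on the compact set \<open>X \<times> U\<close> and its
  composition with continuous \<open>x\<close> and measurable \<open>u\<close> is measurable. Hence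
  the integral in \<open>cost\<close> is not the default value 0.\<close>

lemma traj_running_cost_integrable:
  fixes l :: "(real^'n) \<times> (real^'m) \<Rightarrow> real"
  assumes "compact X" and "compact U" and l: "continuous_on (X \<times> U) l"
    and xu: "(x, u) \<in> traj X U XT f t0 x0"
  shows "(\<lambda>s. l (x s, u s)) absolutely_integrable_on {t0..1}"
proof -
  have "x \<in> borel_measurable (lebesgue_on {t0..1})"
    using traj_continuous[OF xu] by (rule continuous_imp_measurable_on_sets_lebesgue) simp
  \<comment> \<open>Continuity of \<open>l\<close> is known on \<open>X \<times> U\<close> only, so
    the pair must be measurable into the Borel space restricted to that set.\<close>
  then have "(\<lambda>s. (x s, u s)) \<in> measurable (lebesgue_on {t0..1}) (restrict_space borel (X \<times> U))"
    using xu by (auto simp: traj_def measurable_restrict_space2_iff space_restrict_space)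
  then have meas: "(\<lambda>s. l (x s, u s)) \<in> borel_measurable (lebesgue_on {t0..1})"
    by (rule measurable_compose[OF _ borel_measurable_continuous_on_restrict[OF l]])
  obtain B where "\<And>p. p \<in> X \<times> U \<Longrightarrow> norm (l p) \<le> B"
    using compact_imp_bounded[OF compact_continuous_image[OF l]] assms(1,2)
    by (auto simp: bounded_iff compact_Times)
  then have "norm (l (x s, u s)) \<le> B" if "s \<in> {t0..1}" for s
    using xu that by (auto simp: traj_def)
  then show ?thesis
    by (intro measurable_bounded_by_integrable_imp_absolutely_integrable[OF meas, of "\<lambda>_. B"]) auto
qed

section \<open>Total derivative of \<open>v\<close> along a trajectory and the cost identity\<close>

text \<open>This is the chain rule for the space-time curve \<open>(s, x s)\<close> with velocity
  \<open>(1, f (x s, u s))\<close>, bounded by compactness. Derivatives are those of the extension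
  \<open>g\<close>; the endpoint values are those of \<open>v\<close>, which agrees with
  \<open>g\<close> on \<open>{0..1} \<times> X\<close>.\<close>

lemma traj_chain_rule:
  fixes v g :: "real \<times> (real^'n) \<Rightarrow> real" and f :: "(real^'n) \<times> (real^'m) \<Rightarrow> real^'n"
  assumes "compact X" and "compact U" and f: "continuous_on (X \<times> U) f"
    and g: "C1_extension ({0..1} \<times> X) v g"
    and t0: "t0 \<in> {0..1}"
    and xu: "(x, u) \<in> traj X U XT f t0 x0"
  defines "\<phi> \<equiv> \<lambda>s. partial_time g s (x s) + partial_state g s (x s) \<bullet> f (x s, u s)"
  shows "\<phi> absolutely_integrable_on {t0..1}"
    and "(\<phi> has_integral v (1, x 1) - v (t0, x0)) {t0..1}"
proof -
  let ?k = "\<lambda>s. (1::real, f (x s, u s))"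
  obtain g' where g': "\<And>p. p \<in> {0..1} \<times> X \<Longrightarrow> (g has_derivative blinfun_apply (g' p)) (at p)"
      and cont: "continuous_on ({0..1} \<times> X) g'"
      and part: "\<And>t y h. (t, y) \<in> {0..1} \<times> X \<Longrightarrow>
        blinfun_apply (g' (t, y)) (1, h) = partial_time g t y + partial_state g t y \<bullet> h"
    using C1_extension_partials[OF g] by blast
  have in_dom: "(s, x s) \<in> {0..1} \<times> X" if "s \<in> {t0..1}" for s
    using xu t0 that by (auto simp: traj_def)
  have f_abs: "(\<lambda>s. f (x s, u s)) absolutely_integrable_on {t0..1}"
    using xu by (simp add: traj_def)
  obtain B where B: "\<And>p. p \<in> X \<times> U \<Longrightarrow> norm (f p) \<le> B"
    using compact_imp_bounded[OF compact_continuous_image[OF f]] assms(1,2)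
    by (auto simp: bounded_iff compact_Times)
  \<comment> \<open>A constant plus a bounded linear image of the dynamics: integrability and
    integral of the velocity both follow from this form.\<close>
  have k_split: "?k = (\<lambda>s. (1, 0) + (0, f (x s, u s)))"
    by auto
  have emb: "bounded_linear (\<lambda>y::real^'n. (0::real, y))"
    by (simp add: bounded_linear_Pair)
  have "(\<lambda>s. (0::real, f (x s, u s))) absolutely_integrable_on {t0..1}"
    using absolutely_integrable_linear[OF f_abs emb] by (simp add: o_def)
  then have k: "?k absolutely_integrable_on {t0..1}"
    unfolding k_split by (intro set_integral_add(1) absolutely_integrable_on_const) auto
  have M: "norm (?k s) \<le> 1 + B" if "s \<in> {t0..1}" for s
    using norm_Pair_le[of "1::real" "f (x s, u s)"] B[of "(x s, u s)"] xu that
    by (auto simp: traj_def)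
  have x0: "x t0 = x0"
    using traj_initial[OF xu] t0 by simp
  have z: "(t, x t) = (t0, x t0) + integral {t0..t} ?k" if "t \<in> {t0..1}" for t
  proof -
    have "set_integrable lebesgue {t0..t} (\<lambda>s. f (x s, u s))"
      using that by (intro set_integrable_subset[OF f_abs]) auto
    then have "((\<lambda>s. f (x s, u s)) has_integral x t - x t0) {t0..t}"
      using xu that x0 has_integral_set_lebesgue[of "{t0..t}" "\<lambda>s. f (x s, u s)"]
      by (auto simp: traj_def)
    from has_integral_add[OF has_integral_const_real[of "(1, 0)" t0 t] has_integral_linear[OF this emb]]
    have "(?k has_integral (t - t0, x t - x t0)) {t0..t}"
      unfolding k_split using that by (simp add: o_def)
    then show ?thesis
      by (simp add: integral_unique)
  qed
  have contz: "continuous_on {t0..1} (\<lambda>s. g' (s, x s))"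
    by (rule continuous_on_compose2[OF cont])
      (use in_dom in \<open>auto intro!: continuous_intros traj_continuous[OF xu]\<close>)
  have \<phi>: "\<phi> s = blinfun_apply (g' (s, x s)) (?k s)" if "s \<in> {t0..1}" for s
    using part[OF in_dom[OF that]] by (simp add: \<phi>_def)
  note chain = integral_curve_chain_rule[where z = "\<lambda>s. (s, x s)", OF _ k M z g'[OF in_dom] contz]
  show "\<phi> absolutely_integrable_on {t0..1}"
    using chain(1) t0 by (subst set_integrable_cong[OF refl refl \<phi>]) auto
  have "g (1, x 1) = v (1, x 1)" "g (t0, x0) = v (t0, x0)"
    using g in_dom[of 1] in_dom[of t0] t0 x0 by (auto simp: C1_extension_def)
  then show "(\<phi> has_integral v (1, x 1) - v (t0, x0)) {t0..1}"
    using chain(2) t0 x0 by (subst has_integral_cong[OF \<phi>]) auto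
qed

lemma traj_cost_eq:
  fixes v g :: "real \<times> (real^'n) \<Rightarrow> real" and f :: "(real^'n) \<times> (real^'m) \<Rightarrow> real^'n"
  assumes "compact X" and "compact U" and "continuous_on (X \<times> U) f" and "continuous_on (X \<times> U) l"
    and "C1_extension ({0..1} \<times> X) v g"
    and "t0 \<in> {0..1}"
    and "(x, u) \<in> traj X U XT f t0 x0"
  defines "\<psi> \<equiv> \<lambda>s. l (x s, u s) + partial_time g s (x s) + partial_state g s (x s) \<bullet> f (x s, u s)"
  shows "integrable (lebesgue_on {t0..1}) \<psi>"
    and "cost l lT t0 x u =
           v (t0, x0) + (lT (x 1) - v (1, x 1)) + integral\<^sup>L (lebesgue_on {t0..1}) \<psi>"
proof -
  let ?\<phi> = "\<lambda>s. partial_time g s (x s) + partial_state g s (x s) \<bullet> f (x s, u s)"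
  have \<phi>: "?\<phi> absolutely_integrable_on {t0..1}"
      "(?\<phi> has_integral v (1, x 1) - v (t0, x0)) {t0..1}"
    using traj_chain_rule[OF assms(1-3,5-7)] by auto
  have l: "(\<lambda>s. l (x s, u s)) absolutely_integrable_on {t0..1}"
    using traj_running_cost_integrable assms(1,2,4,7) by blast
  have \<psi>: "\<psi> = (\<lambda>s. l (x s, u s) + ?\<phi> s)"
    by (auto simp: \<psi>_def)
  have \<psi>_abs: "\<psi> absolutely_integrable_on {t0..1}"
    unfolding \<psi> using l \<phi>(1) by (rule set_integral_add)
  then show \<psi>_int: "integrable (lebesgue_on {t0..1}) \<psi>"
    by (simp add: integrable_restrict_space set_integrable_def)
  have "integral\<^sup>L (lebesgue_on {t0..1}) \<psi> = integral {t0..1} \<psi>"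
    using \<psi>_int by (rule lebesgue_integral_eq_integral) simp
  also have "\<dots> = (LINT s:{t0..1}|lebesgue. l (x s, u s)) + (v (1, x 1) - v (t0, x0))"
    unfolding \<psi> using has_integral_add[OF has_integral_set_lebesgue[OF l] \<phi>(2)]
    by (rule integral_unique)
  finally show "cost l lT t0 x u =
      v (t0, x0) + (lT (x 1) - v (1, x 1)) + integral\<^sup>L (lebesgue_on {t0..1}) \<psi>"
    by (simp add: cost_def)
qed

section \<open>Bounds on the value function and suboptimality\<close>

lemma C1_on_imp_continuous_on:
  assumes "C1_on A h"
  shows "continuous_on A h"
proof -
  obtain g W g' where "A \<subseteq> W" and "\<And>z. z \<in> W \<Longrightarrow> (g has_derivative blinfun_apply (g' z)) (at z)"
      and eq: "\<And>z. z \<in> A \<Longrightarrow> g z = h z"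
    using assms unfolding C1_on_def C1_extension_def continuously_differentiable_def by metis
  then have "continuous_on A g"
    by (meson continuous_at_imp_continuous_on has_derivative_continuous subsetD)
  then show ?thesis
    using eq by (simp cong: continuous_on_cong)
qed

theorem proposition2:
  fixes X XT :: "(real^'n) set" and U :: "(real^'m) set"
    and f :: "(real^'n) \<times> (real^'m) \<Rightarrow> real^'n"
    and l :: "(real^'n) \<times> (real^'m) \<Rightarrow> real"
    and lT :: "real^'n \<Rightarrow> real"
    and t0 \<epsilon> :: real and x0 :: "real^'n"
    and x :: "real \<Rightarrow> real^'n" and u :: "real \<Rightarrow> real^'m"
    and v v_ext :: "real \<times> (real^'n) \<Rightarrow> real"
  assumes "compact X" and "compact U" and "XT \<subseteq> X" and "compact XT"
    and "C1_on (X \<times> U) f" and "continuous_on (X \<times> U) l" and "continuous_on XT lT"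
    and "(t0, x0) \<in> value_domain X U XT f"
    and "(x, u) \<in> traj X U XT f t0 x0"
    and "\<epsilon> > 0"
    and "C1_extension ({0..1} \<times> X) v v_ext"
    and "AE t in lebesgue_on {t0..1}.
           l (x t, u t) + partial_time v_ext t (x t)
             + partial_state v_ext t (x t) \<bullet> f (x t, u t) \<le> \<epsilon> / 2"
    and "lT (x 1) - v (1, x 1) \<le> \<epsilon> / 2"
  shows "(\<forall>t\<in>{t0..1}. value_function X U XT f l lT t (x t) \<le> ereal (v (t, x t) + \<epsilon>)) \<and>
         ((\<forall>y\<in>X. \<forall>w\<in>U. \<forall>t\<in>{0..1}.
             l (y, w) + partial_time v_ext t y + partial_state v_ext t y \<bullet> f (y, w) \<ge> 0) \<longrightarrow>
          (\<forall>y\<in>XT. lT y - v (1, y) \<ge> 0) \<longrightarrow>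
          (x, u) \<in> traj X U XT f t0 x0 \<and>
          ereal (cost l lT t0 x u) \<le> value_function X U XT f l lT t0 x0 + ereal \<epsilon>)"
proof -
  have t0: "t0 \<in> {0..1}"
    using assms(8) by (simp add: value_domain_def)
  have f: "continuous_on (X \<times> U) f"
    using assms(5) by (rule C1_on_imp_continuous_on)
  note cost_eq = traj_cost_eq[OF assms(1,2) f assms(6,11)]
  have upper: "cost l lT t x u \<le> v (t, x t) + \<epsilon>" if t: "t \<in> {t0..1}" for t
  proof -
    let ?\<psi> = "\<lambda>s. l (x s, u s) + partial_time v_ext s (x s)
      + partial_state v_ext s (x s) \<bullet> f (x s, u s)"
    have t': "t \<in> {0..1}"
      using t t0 by auto
    have xu: "(x, u) \<in> traj X U XT f t (x t)"
      using assms(9) t by (rule traj_restrict)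
    have "AE s in lebesgue_on {t..1}. ?\<psi> s \<le> \<epsilon> / 2"
      using assms(12) t by (auto simp: AE_restrict_space_iff elim!: eventually_mono)
    then have "integral\<^sup>L (lebesgue_on {t..1}) ?\<psi> \<le> integral\<^sup>L (lebesgue_on {t..1}) (\<lambda>_. \<epsilon> / 2)"
      using cost_eq(1)[OF t' xu] by (intro integral_mono_AE) auto
    \<comment> \<open>The remaining horizon \<open>1 - t\<close> is at most 1, so the integral costs
      at most \<epsilon>/2; the terminal defect supplies the other half.\<close>
    also have "\<dots> = (1 - t) * (\<epsilon> / 2)"
      using t by (simp add: measure_restrict_space)
    also have "\<dots> \<le> \<epsilon> / 2"
      using t' \<open>\<epsilon> > 0\<close> by (simp add: field_simps)
    finally show ?thesis
      using cost_eq(2)[OF t' xu, of lT] assms(13) by simp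
  qed
  have value_le: "value_function X U XT f l lT t (x t) \<le> ereal (v (t, x t) + \<epsilon>)"
    if t: "t \<in> {t0..1}" for t
  proof -
    have "value_function X U XT f l lT t (x t) \<le> ereal (cost l lT t x u)"
      unfolding value_function_def using traj_restrict[OF assms(9) t] by (intro INF_lower2) auto
    then show ?thesis
      using upper[OF t] by (meson ereal_less_eq(3) order_trans)
  qed
  moreover have "ereal (cost l lT t0 x u) \<le> value_function X U XT f l lT t0 x0 + ereal \<epsilon>"
    if HJB: "\<forall>y\<in>X. \<forall>w\<in>U. \<forall>t\<in>{0..1}.
          l (y, w) + partial_time v_ext t y + partial_state v_ext t y \<bullet> f (y, w) \<ge> 0"
      and terminal: "\<forall>y\<in>XT. lT y - v (1, y) \<ge> 0"
  proof -
    \<comment> \<open>The exact inequalities hold at every state, control and time, so they apply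
      along any competitor \<open>(y, w)\<close> and both corrections in the cost identity are
      nonnegative.\<close>
    have "v (t0, x0) \<le> cost l lT t0 y w" if yw: "(y, w) \<in> traj X U XT f t0 x0" for y w
    proof -
      have "integral\<^sup>L (lebesgue_on {t0..1}) (\<lambda>s. l (y s, w s) + partial_time v_ext s (y s)
          + partial_state v_ext s (y s) \<bullet> f (y s, w s)) \<ge> 0"
        using HJB yw t0 by (intro integral_nonneg_AE AE_I2) (auto simp: traj_def)
      moreover have "lT (y 1) - v (1, y 1) \<ge> 0"
        using terminal yw by (auto simp: traj_def)
      ultimately show ?thesis
        using cost_eq(2)[OF t0 yw, of lT] by simp
    qed
    then have "ereal (v (t0, x0)) \<le> value_function X U XT f l lT t0 x0"
      unfolding value_function_def by (intro INF_greatest) auto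
    then have "ereal (v (t0, x0)) + ereal \<epsilon> \<le> value_function X U XT f l lT t0 x0 + ereal \<epsilon>"
      by (rule add_right_mono)
    \<comment> \<open>The number \<open>v (t0, x0)\<close> links the two sides: it is at most the
      optimal value, and the cost of \<open>(x, u)\<close> exceeds it by at most \<epsilon>.\<close>
    moreover have "cost l lT t0 x u \<le> v (t0, x0) + \<epsilon>"
      using upper[of t0] t0 traj_initial[OF assms(9)] by simp
    ultimately show ?thesis
      by (metis ereal_less_eq(3) order_trans plus_ereal.simps(1))
  qed
  ultimately show ?thesis
    using assms(9) by blast
qed

end
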